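(* Let $\mathcal{H}$ be a complex separable Hilbert space and let $\mathcal{M},\mathcal{N}$ be linear subspaces of $\mathcal{H}$ such that $P_{\mathcal{M},\mathcal{N}}$ is decomposable. Then $P_{\mathcal{M},\mathcal{N}}$ is continuous if and only if $\mathcal{M}^{\perp}+\mathcal{N}^{\perp}$ is closed.
   Context: A linear relation on $\mathcal{H}$ is a linear subspace $T$ of $\mathcal{H}\times\mathcal{H}$; operators are identified with their graphs. $\operatorname{dom}T$ is the set of first components, $\operatorname{mul}T=\{y:(0,y)\in T\}$. The adjoint is $T^*=\{(x,y):\langle g,x\rangle=\langle f,y\rangle\ \forall(f,g)\in T\}$. For a relation $T$, $T_0:=T\cap(\overline{\operatorname{dom}}\,T\times\overline{\operatorname{dom}}\,T^* )$ (an operator), and $T$ is decomposable if $\operatorname{dom}T_0=\operatorname{dom}T$. $T$ is continuous if for every neighbourhood $V$ in $\operatorname{ran}T$, $T^{-1}(V)$ is a neighbourhood in $\operatorname{dom}T$; equivalently, the operator $T_m:=QT=\{(x,Qy):(x,y)\in T\}$, with $Q$ the orthogonal projection onto $(\operatorname{mul}T)^{\perp}$, is bounded on $\operatorname{dom}T$. For subspaces $\mathcal{M},\mathcal{N}$, $P_{\mathcal{M},\mathcal{N}}=\{(m+n,m):m\in\mathcal{M},n\in\mathcal{N}\}$, with domain $\mathcal{M}+\mathcal{N}$ and multivalued part $\mathcal{M}\cap\mathcal{N}$. *)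

theory Defs
  imports "HOL-Analysis.Analysis"
begin

section \<open>Complex Hilbert spaces\<close>

text \<open>
  A complex inner product space is presented over its underlying real one: the real inner product
  is the real part of \<^term>\<open>cinner\<close>. As \<^term>\<open>cinner x x\<close> is real by conjugate symmetry,
  positive definiteness and \<open>norm x = sqrt (cinner x x)\<close> are inherited from \<^class>\<open>real_inner\<close>.
  The form is linear in its first argument.
\<close>

class complex_inner = real_inner +
  fixes scaleC :: "complex \<Rightarrow> 'a \<Rightarrow> 'a" (infixr \<open>*\<^sub>C\<close> 75)
    and cinner :: "'a \<Rightarrow> 'a \<Rightarrow> complex"
  assumes scaleC_add_right: "c *\<^sub>C (x + y) = c *\<^sub>C x + c *\<^sub>C y"
    and scaleC_add_left: "(c + d) *\<^sub>C x = c *\<^sub>C x + d *\<^sub>C x"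
    and scaleC_scaleC: "c *\<^sub>C d *\<^sub>C x = (c * d) *\<^sub>C x"
    and scaleC_one: "1 *\<^sub>C x = x"
    and scaleR_scaleC: "r *\<^sub>R x = complex_of_real r *\<^sub>C x"
    and cinner_commute: "cinner x y = cnj (cinner y x)"
    and cinner_add_left: "cinner (x + y) z = cinner x z + cinner y z"
    and cinner_scaleC_left: "cinner (c *\<^sub>C x) y = c * cinner x y"
    and inner_eq_Re_cinner: "inner x y = Re (cinner x y)"

class complex_hilbert_space = complex_inner + complete_space

global_interpretation complex_vector: vector_space "scaleC :: complex \<Rightarrow> 'a \<Rightarrow> 'a::complex_inner"
  by unfold_locales (simp_all add: scaleC_add_right scaleC_add_left scaleC_scaleC scaleC_one)

abbreviation csubspace :: "'a::complex_inner set \<Rightarrow> bool"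
  where "csubspace \<equiv> complex_vector.subspace"

lemma cinner_self_real: "cinner x x = complex_of_real (inner x x)"
  using arg_cong[OF cinner_commute[of x x], of Im]
  by (simp add: complex_eq_iff inner_eq_Re_cinner)

lemma norm_eq_sqrt_cinner: "complex_of_real (norm x) = csqrt (cinner x x)"
  by (subst cinner_self_real, subst of_real_sqrt[symmetric])
    (simp_all only: inner_ge_zero norm_eq_sqrt_inner)

instantiation complex :: complex_hilbert_space
begin

definition scaleC_complex :: "complex \<Rightarrow> complex \<Rightarrow> complex"
  where "scaleC_complex c x = c * x"

definition cinner_complex :: "complex \<Rightarrow> complex \<Rightarrow> complex"
  where "cinner_complex x y = x * cnj y"

instance
  by standard
    (simp_all add: scaleC_complex_def cinner_complex_def inner_complex_def algebra_simps
      scaleR_conv_of_real)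

end

definition ortho_compl :: "'a::complex_inner set \<Rightarrow> 'a set"
  where "ortho_compl M = {x. \<forall>m\<in>M. cinner x m = 0}"


section \<open>Linear relations\<close>

text \<open>
  A linear relation is a linear subspace of the product; linearity plays no role in the definitions
  below, so they are stated for arbitrary sets of pairs.
\<close>

definition rel_mul :: "('a::complex_inner \<times> 'a) set \<Rightarrow> 'a set"
  where "rel_mul T = {y. (0, y) \<in> T}"

definition rel_adjoint :: "('a::complex_inner \<times> 'a) set \<Rightarrow> ('a \<times> 'a) set"
  where "rel_adjoint T = {(x, y). \<forall>(f, g)\<in>T. cinner g x = cinner f y}"

definition rel_op_part :: "('a::complex_inner \<times> 'a) set \<Rightarrow> ('a \<times> 'a) set"
  where "rel_op_part T = T \<inter> (closure (Domain T) \<times> closure (Domain (rel_adjoint T)))"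

definition rel_decomposable :: "('a::complex_inner \<times> 'a) set \<Rightarrow> bool"
  where "rel_decomposable T \<longleftrightarrow> Domain (rel_op_part T) = Domain T"

definition neighbourhood_in :: "'a::topological_space set \<Rightarrow> 'a \<Rightarrow> 'a set \<Rightarrow> bool"
  where "neighbourhood_in S x V \<longleftrightarrow> V \<subseteq> S \<and> x \<in> (top_of_set S) interior_of V"

text \<open>
  The preimage \<open>T\<inverse> `` V\<close> consists of all \<open>x\<close> having \<^emph>\<open>some\<close> \<open>y \<in> V\<close> with \<open>(x, y) \<in> T\<close>,
  so this is lower semicontinuity of the multivalued map \<open>T\<close>.
\<close>

definition rel_continuous :: "('a::complex_inner \<times> 'a) set \<Rightarrow> bool"
  where "rel_continuous T \<longleftrightarrow>
    (\<forall>(x, y)\<in>T. \<forall>V. neighbourhood_in (Range T) y V \<longrightarrow> neighbourhood_in (Domain T) x (T\<inverse> `` V))"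

definition proj_rel :: "'a::complex_inner set \<Rightarrow> 'a set \<Rightarrow> ('a \<times> 'a) set"
  where "proj_rel M N = {(m + n, m) | m n. m \<in> M \<and> n \<in> N}"

lemma Domain_proj_rel: "Domain (proj_rel M N) = M + N"
  by (auto simp: proj_rel_def set_plus_def)

lemma rel_mul_proj_rel:
  assumes "csubspace N"
  shows "rel_mul (proj_rel M N) = M \<inter> N"
proof -
  have "(0, y) \<in> proj_rel M N \<longleftrightarrow> y \<in> M \<and> - y \<in> N" for y
    unfolding proj_rel_def by (force simp: add_eq_0_iff)
  moreover have "- y \<in> N \<longleftrightarrow> y \<in> N" for y
    using complex_vector.subspace_neg[OF assms] by force
  ultimately show ?thesis
    by (auto simp: rel_mul_def)
qed

end

theory Submission
  imports Defs
begin

text \<open>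
  Let \<open>W\<close> be the closure of \<open>M\<^sup>\<bottom> + N\<^sup>\<bottom>\<close>, the domain of the adjoint. Decomposability says that
  every \<open>m \<in> M\<close> lies in \<open>W\<close> modulo \<open>M \<inter> N\<close>, and \<open>M \<inter> N\<close> is orthogonal to \<open>W\<close>. Hence continuity
  amounts to an estimate \<open>\<parallel>m\<parallel> \<le> C \<parallel>m + n\<parallel>\<close> for \<open>m \<in> M \<inter> W\<close> and \<open>n \<in> N\<close>. If
  \<open>M\<^sup>\<bottom> + N\<^sup>\<bottom>\<close> is closed, then for \<open>p = a + b \<in> W\<close> with \<open>a \<bottom> M\<close>, \<open>b \<bottom> N\<close> we have
  \<open>\<langle>m, p\<rangle> = \<langle>m + n, b\<rangle>\<close>, so those \<open>m\<close> with \<open>\<parallel>m + n\<parallel> \<le> 1\<close> for some \<open>n\<close> form a weakly bounded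
  set, which is bounded by Banach--Steinhaus. Conversely, the estimate lets the Riesz theorem
  decompose each \<open>z \<in> W\<close>. Real inner products suffice, since orthogonality to a complex subspace
  is the same for both forms.
\<close>

section \<open>Hilbert space preliminaries\<close>

text \<open>
  The representing vector is the minimiser of \<open>\<parallel>x\<parallel>\<^sup>2 - 2 f x\<close>; as \<open>S\<close> need not be closed,
  it is only found in the closure of \<open>S\<close>.
\<close>

lemma riesz_on_subspace:
  fixes S :: "'a::{real_inner,complete_space} set" and f :: "'a \<Rightarrow> real"
  assumes S: "subspace S"
    and add: "\<And>x y. x \<in> S \<Longrightarrow> y \<in> S \<Longrightarrow> f (x + y) = f x + f y"
    and scale: "\<And>c x. x \<in> S \<Longrightarrow> f (c *\<^sub>R x) = c * f x"
    and bound: "\<And>x. x \<in> S \<Longrightarrow> \<bar>f x\<bar> \<le> C * norm x"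
  obtains b where "b \<in> closure S" "\<And>s. s \<in> S \<Longrightarrow> inner b s = f s"
proof -
  define F where "F x = (norm x)\<^sup>2 - 2 * f x" for x
  define d where "d = (INF x\<in>S. F x)"
  have "- C\<^sup>2 \<le> F x" if "x \<in> S" for x
  proof -
    have "0 \<le> (norm x - C)\<^sup>2" by simp
    then show ?thesis
      using bound[OF that] by (simp add: F_def power2_eq_square algebra_simps)
  qed
  then have bdd: "bdd_below (F ` S)"
    by (auto intro!: bdd_belowI)
  have d_le: "d \<le> F x" if "x \<in> S" for x
    unfolding d_def using bdd that by (rule cINF_lower)
  have "S \<noteq> {}"
    using subspace_0[OF S] by auto
  have "\<exists>x\<in>S. F x < d + 1 / real (Suc n)" for n
    using cINF_less_iff[OF \<open>S \<noteq> {}\<close> bdd, of "d + 1 / real (Suc n)"]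
    by (simp flip: d_def)
  then obtain X where XS: "\<And>n. X n \<in> S" and X: "\<And>n. F (X n) < d + 1 / real (Suc n)"
    by metis
  have FX: "(\<lambda>n. F (X n)) \<longlonglongrightarrow> d"
  proof (rule tendsto_sandwich[OF _ _ tendsto_const])
    show "(\<lambda>n. d + 1 / real (Suc n)) \<longlonglongrightarrow> d"
      using tendsto_add[OF tendsto_const LIMSEQ_inverse_real_of_nat, of d]
      by (simp add: inverse_eq_divide)
  qed (use less_imp_le[OF X] XS d_le in \<open>auto intro!: always_eventually\<close>)
  \<comment> \<open>Parallelogram law: the midpoint of \<open>x\<close> and \<open>y\<close> also
    has value at least \<open>d\<close>, so near-minimisers are close together and a minimising
    sequence is Cauchy.\<close>
  have par: "(norm (x - y))\<^sup>2 \<le> 2 * (F x - d) + 2 * (F y - d)" if "x \<in> S" "y \<in> S" for x y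
  proof -
    have mid: "(1/2) *\<^sub>R (x + y) \<in> S"
      using S that by (simp add: subspace_add subspace_scale)
    have "f ((1/2) *\<^sub>R (x + y)) = (f x + f y) / 2"
      using that S by (simp add: scale add subspace_add)
    moreover have "4 * (norm ((1/2) *\<^sub>R (x + y)))\<^sup>2 = (norm (x + y))\<^sup>2"
      by (simp add: power_mult_distrib power_divide)
    ultimately show ?thesis
      using d_le[OF mid] unfolding F_def
      by (simp add: power2_norm_eq_inner inner_simps inner_commute)
  qed
  have "Cauchy X"
  proof (rule metric_CauchyI)
    fix e :: real assume "0 < e"
    have "\<forall>\<^sub>F n in sequentially. F (X n) < d + e\<^sup>2 / 4"
      using FX \<open>0 < e\<close> by (intro order_tendstoD(2)) auto
    then obtain n0 where n0: "\<And>n. n \<ge> n0 \<Longrightarrow> F (X n) < d + e\<^sup>2 / 4"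
      by (auto simp: eventually_sequentially)
    have "dist (X m) (X n) < e" if "m \<ge> n0" "n \<ge> n0" for m n
    proof -
      have "(norm (X m - X n))\<^sup>2 < e\<^sup>2"
        using par[OF XS XS, of m n] n0[OF that(1)] n0[OF that(2)] by simp
      then show ?thesis
        using \<open>0 < e\<close> by (simp add: dist_norm power_less_imp_less_base)
    qed
    then show "\<exists>n0. \<forall>m\<ge>n0. \<forall>n\<ge>n0. dist (X m) (X n) < e"
      by blast
  qed
  then obtain b where b: "X \<longlonglongrightarrow> b"
    using Cauchy_convergent convergent_def by blast
  have "b \<in> closure S"
    using b XS closure_sequential by blast
  moreover have "inner b s = f s" if s: "s \<in> S" for s
  proof -
    \<comment> \<open>The limit \<open>b\<close> may lie outside \<open>S\<close>, where nothing is
      assumed of \<open>f\<close>; so the variation in direction \<open>s\<close> is made at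
      \<open>X n\<close>, and then \<open>n\<close> tends to infinity.\<close>
    have quad: "0 \<le> 2 * t * (inner b s - f s) + t\<^sup>2 * (norm s)\<^sup>2" for t
    proof -
      have "d \<le> F (X n) + (2 * t * (inner (X n) s - f s) + t\<^sup>2 * (norm s)\<^sup>2)" for n
      proof -
        have "X n + t *\<^sub>R s \<in> S"
          using S s XS by (simp add: subspace_add subspace_scale)
        moreover have "f (X n + t *\<^sub>R s) = f (X n) + t * f s"
          using S s XS by (simp add: add scale subspace_scale)
        moreover have "(norm (X n + t *\<^sub>R s))\<^sup>2
            = (norm (X n))\<^sup>2 + 2 * t * inner (X n) s + t\<^sup>2 * (norm s)\<^sup>2"
          unfolding power2_norm_eq_inner
          by (simp add: inner_simps inner_commute power2_eq_square[of t] algebra_simps)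
        ultimately show ?thesis
          using d_le[of "X n + t *\<^sub>R s"] unfolding F_def by (simp add: algebra_simps)
      qed
      moreover have "(\<lambda>n. F (X n) + (2 * t * (inner (X n) s - f s) + t\<^sup>2 * (norm s)\<^sup>2))
          \<longlonglongrightarrow> d + (2 * t * (inner b s - f s) + t\<^sup>2 * (norm s)\<^sup>2)"
        by (intro tendsto_intros FX b)
      ultimately have "d \<le> d + (2 * t * (inner b s - f s) + t\<^sup>2 * (norm s)\<^sup>2)"
        by (meson LIMSEQ_le_const)
      then show ?thesis by simp
    qed
    show ?thesis
    proof (cases "s = 0")
      case True
      then show ?thesis using scale[of 0 0] s by simp
    next
      case False
      define a where "a = inner b s - f s"
      \<comment> \<open>This value of \<open>t\<close> minimises the quadratic in
        \<open>quad\<close>.\<close>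
      have "0 \<le> 2 * (- a / (norm s)\<^sup>2) * a + (- a / (norm s)\<^sup>2)\<^sup>2 * (norm s)\<^sup>2"
        using quad[of "- a / (norm s)\<^sup>2"] by (simp add: a_def)
      also have "\<dots> = - (a\<^sup>2 / (norm s)\<^sup>2)"
        using False by (simp add: power2_eq_square field_simps)
      finally have "a\<^sup>2 / (norm s)\<^sup>2 \<le> 0" by simp
      then have "a = 0"
        using False by (simp add: divide_le_0_iff)
      then show ?thesis by (simp add: a_def)
    qed
  qed
  ultimately show thesis by (rule that)
qed

lemma orthogonal_projection_exists:
  fixes S :: "'a::{real_inner,complete_space} set"
  assumes "subspace S" "closed S"
  obtains p where "p \<in> S" "\<And>s. s \<in> S \<Longrightarrow> inner s z = inner s p"
proof -
  obtain p where "p \<in> closure S" "\<And>s. s \<in> S \<Longrightarrow> inner p s = inner z s"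
    using riesz_on_subspace[OF assms(1), of "inner z" "norm z"]
    by (metis inner_add_right inner_scaleR_right Cauchy_Schwarz_ineq2)
  then show thesis
    using assms(2) that by (metis closure_closed inner_commute)
qed

text \<open>Banach-Steinhaus by Baire category: the closed sets \<open>E n\<close> cover the space,
  so one of them contains a ball, and moving inside that ball tests each \<open>s\<close> in its own
  direction.\<close>

lemma weakly_bounded_imp_bounded:
  fixes S :: "'a::{real_inner,complete_space} set"
  assumes "\<And>z. \<exists>c. \<forall>s\<in>S. \<bar>inner s z\<bar> \<le> c"
  shows "bounded S"
proof -
  define E where "E n = {z. \<forall>s\<in>S. \<bar>inner s z\<bar> \<le> real n}" for n
  have "closed (E n)" for n
  proof -
    have "E n = (\<Inter>s\<in>S. {z. \<bar>inner s z\<bar> \<le> real n})"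
      by (auto simp: E_def)
    then show ?thesis
      by (auto intro!: closed_Collect_le continuous_intros)
  qed
  moreover have "(\<Union>n. E n) = UNIV"
  proof -
    have "\<exists>n. z \<in> E n" for z
    proof -
      obtain c where c: "\<forall>s\<in>S. \<bar>inner s z\<bar> \<le> c"
        using assms by blast
      obtain n where "c \<le> real n"
        using real_arch_simple by blast
      with c show ?thesis
        unfolding E_def by (blast intro: order_trans)
    qed
    then show ?thesis by blast
  qed
  ultimately obtain n where "interior (E n) \<noteq> {}"
    using Baire_category_alt[of "euclidean :: 'a topology" "range E"]
      completely_metrizable_space_euclidean[where 'a='a]
    by fastforce
  then obtain z0 r where r: "0 < r" "cball z0 r \<subseteq> E n"
    by (meson all_not_in_conv mem_interior_cball)
  have "norm s \<le> 2 * real n / r" if s: "s \<in> S" for s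
  proof (cases "s = 0")
    case False
    define w where "w = (r / norm s) *\<^sub>R s"
    have "z0 + w \<in> E n" "z0 \<in> E n"
      using r False by (auto simp: w_def dist_norm intro!: subsetD[OF r(2)])
    then have "\<bar>inner s (z0 + w)\<bar> \<le> real n" "\<bar>inner s z0\<bar> \<le> real n"
      using s by (auto simp: E_def)
    then have "inner s w \<le> 2 * real n"
      by (simp add: inner_add_right)
    moreover have "inner s w = r * norm s"
      using False by (simp add: w_def dot_square_norm power2_eq_square)
    ultimately show ?thesis
      using r(1) by (simp add: field_simps)
  qed (use r in simp)
  then show ?thesis
    by (auto simp: bounded_iff)
qed


section \<open>The angle estimate\<close>

lemma subspace_set_plus:
  assumes "subspace A" "subspace B"
  shows "subspace (A + B)"
proof -
  have "A + B = {x + y |x y. x \<in> A \<and> y \<in> B}"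
    by (auto simp: set_plus_def)
  then show ?thesis
    using subspace_sums[OF assms] by simp
qed

lemma orthogonal_comp_inner: "x \<in> orthogonal_comp M \<longleftrightarrow> (\<forall>m\<in>M. inner m x = 0)"
  by (simp add: orthogonal_comp_def orthogonal_def)

text \<open>Such a \<open>k\<close> is orthogonal to both summands, and orthogonality to
  \<open>k\<close> is a closed condition.\<close>

lemma inter_orthogonal_closure_sum:
  assumes "k \<in> M \<inter> N" "w \<in> closure (orthogonal_comp M + orthogonal_comp N)"
  shows "inner k w = 0"
proof -
  have "closed {w. inner k w = 0}"
    by (intro closed_Collect_eq continuous_intros)
  moreover have "orthogonal_comp M + orthogonal_comp N \<subseteq> {w. inner k w = 0}"
    using assms(1) by (auto simp: set_plus_def orthogonal_comp_inner inner_add_right)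
  ultimately show ?thesis
    using closure_minimal assms(2) by blast
qed

lemma angle_estimate_if_closed:
  fixes M N :: "'a::{real_inner,complete_space} set"
  defines "W \<equiv> orthogonal_comp M + orthogonal_comp N"
  assumes M: "subspace M" and N: "subspace N" and W: "closed W"
  shows "\<exists>C. \<forall>m\<in>M \<inter> W. \<forall>n\<in>N. norm m \<le> C * norm (m + n)"
proof -
  define S where "S = {m \<in> M \<inter> W. \<exists>n\<in>N. norm (m + n) \<le> 1}"
  have "bounded S"
  proof (rule weakly_bounded_imp_bounded)
    fix z
    \<comment> \<open>Elements of \<open>S\<close> lie in \<open>W\<close>, so they see only the
      projection \<open>p\<close> of \<open>z\<close>, and \<open>p\<close> can be split.\<close>
    obtain p where "p \<in> W" and p: "\<And>w. w \<in> W \<Longrightarrow> inner w z = inner w p"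
      using orthogonal_projection_exists[of W z] W
      by (metis W_def subspace_set_plus subspace_orthogonal_comp)
    then obtain a b where ab: "p = a + b" "a \<in> orthogonal_comp M" "b \<in> orthogonal_comp N"
      by (auto simp: W_def set_plus_def)
    have "\<bar>inner m z\<bar> \<le> norm b" if "m \<in> S" for m
    proof -
      obtain n where mn: "m \<in> M" "m \<in> W" "n \<in> N" "norm (m + n) \<le> 1"
        using \<open>m \<in> S\<close> by (auto simp: S_def)
      have "inner m z = inner (m + n) b"
        using mn ab p by (simp add: orthogonal_comp_inner inner_simps)
      also have "\<bar>\<dots>\<bar> \<le> norm (m + n) * norm b"
        by (rule Cauchy_Schwarz_ineq2)
      also have "\<dots> \<le> norm b"
        using mn(4) by (simp add: mult_left_le_one_le)
      finally show ?thesis .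
    qed
    then show "\<exists>c. \<forall>s\<in>S. \<bar>inner s z\<bar> \<le> c"
      by blast
  qed
  then obtain C where C: "\<And>m. m \<in> S \<Longrightarrow> norm m \<le> C"
    by (auto simp: bounded_iff)
  have subW: "subspace W"
    unfolding W_def by (intro subspace_set_plus subspace_orthogonal_comp)
  have scaled: "norm (t *\<^sub>R m) \<le> C" if "m \<in> M \<inter> W" "n \<in> N" "norm (t *\<^sub>R (m + n)) \<le> 1" for t m n
  proof (rule C)
    have "t *\<^sub>R n \<in> N" "t *\<^sub>R m \<in> M \<inter> W"
      using that M N subW by (auto intro: subspace_scale)
    then show "t *\<^sub>R m \<in> S"
      using that(3) unfolding S_def scaleR_add_right by blast
  qed
  have "norm m \<le> C * norm (m + n)" if mn: "m \<in> M \<inter> W" "n \<in> N" for m n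
  proof (cases "m + n = 0")
    case True
    \<comment> \<open>Every multiple of \<open>m\<close> lies in the bounded set \<open>S\<close>,
      which forces \<open>m = 0\<close>.\<close>
    then have "\<bar>t\<bar> * norm m \<le> C" for t
      using scaled[OF mn, of t] by simp
    then have "real k * norm m \<le> C" for k
      by (metis abs_of_nat)
    then show ?thesis
      using True reals_Archimedean3[of "norm m"] by (metis linorder_not_less norm_ge_zero
          less_eq_real_def norm_zero mult_zero_right)
  next
    case False
    then have "norm ((1 / norm (m + n)) *\<^sub>R (m + n)) \<le> 1"
      by simp
    from scaled[OF mn this] False show ?thesis
      by (simp add: field_simps)
  qed
  then show ?thesis by blast
qed

text \<open>
  For \<open>z\<close> in the closure, the functional \<open>m + n \<mapsto> \<langle>m, z\<rangle>\<close> is well defined and bounded on \<open>M + N\<close>;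
  a vector \<open>b\<close> representing it splits \<open>z\<close> as \<open>(z - b) + b\<close>.
\<close>

lemma closed_if_angle_estimate:
  fixes M N :: "'a::{real_inner,complete_space} set"
  defines "W \<equiv> closure (orthogonal_comp M + orthogonal_comp N)"
  assumes M: "subspace M" and N: "subspace N"
    and dec: "\<And>m. m \<in> M \<Longrightarrow> \<exists>k\<in>M \<inter> N. m - k \<in> W"
    and C: "\<And>m n. m \<in> M \<inter> W \<Longrightarrow> n \<in> N \<Longrightarrow> norm m \<le> C * norm (m + n)"
  shows "closed (orthogonal_comp M + orthogonal_comp N)"
proof -
  have "z \<in> orthogonal_comp M + orthogonal_comp N" if z: "z \<in> W" for z
  proof -
    have kz: "inner k z = 0" if "k \<in> M" "k \<in> N" for k
      using inter_orthogonal_closure_sum[of k M N z] that z unfolding W_def by blast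
    \<comment> \<open>Two choices of the \<open>M\<close>-component differ by an element of
      \<open>M \<inter> N\<close>, which is orthogonal to \<open>z\<close>; hence the value does not
      depend on the choice.\<close>
    define f where "f v = inner (SOME m. m \<in> M \<and> v - m \<in> N) z" for v
    have f: "f (m + n) = inner m z" if mn: "m \<in> M" "n \<in> N" for m n
    proof -
      define m' where "m' = (SOME m'. m' \<in> M \<and> m + n - m' \<in> N)"
      have "m' \<in> M \<and> m + n - m' \<in> N"
        unfolding m'_def by (rule someI[of _ m]) (use mn in simp)
      moreover have "m - m' = (m + n - m') - n" by simp
      ultimately have "m - m' \<in> M" "m - m' \<in> N"
        using mn M N by (metis subspace_diff)+
      then have "inner (m - m') z = 0"
        by (rule kz)
      then show ?thesis
        by (simp add: f_def m'_def inner_diff_left)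
    qed
    have bound: "\<bar>f (m + n)\<bar> \<le> (C * norm z) * norm (m + n)" if mn: "m \<in> M" "n \<in> N" for m n
    proof -
      \<comment> \<open>Passing from \<open>(m, n)\<close> to \<open>(m - k, n + k)\<close> keeps
        the sum and the value of \<open>f\<close>, and brings the first component into
        \<open>W\<close>, where the estimate applies.\<close>
      obtain k where k: "k \<in> M" "k \<in> N" "m - k \<in> W"
        using dec mn by blast
      have "f (m + n) = inner (m - k) z"
        using f[OF mn] kz[OF k(1,2)] by (simp add: inner_diff_left)
      also have "\<bar>\<dots>\<bar> \<le> norm (m - k) * norm z"
        by (rule Cauchy_Schwarz_ineq2)
      also have "norm (m - k) \<le> C * norm ((m - k) + (k + n))"
        using k mn M N by (intro C) (auto intro: subspace_diff subspace_add)
      finally show ?thesis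
        by (simp add: mult_right_mono algebra_simps)
    qed
    obtain b where b: "\<And>s. s \<in> M + N \<Longrightarrow> inner b s = f s"
    proof (rule riesz_on_subspace[of "M + N" f "C * norm z"])
      show "subspace (M + N)"
        using M N by (rule subspace_set_plus)
    next
      fix x y assume "x \<in> M + N" "y \<in> M + N"
      then obtain m n m' n' where *: "m \<in> M" "n \<in> N" "m' \<in> M" "n' \<in> N" "x = m + n" "y = m' + n'"
        by (auto simp: set_plus_def)
      moreover have "x + y = (m + m') + (n + n')"
        using * by simp
      ultimately show "f (x + y) = f x + f y"
        using M N by (simp only: f subspace_add inner_add_left)
    next
      fix c x assume "x \<in> M + N"
      then obtain m n where "m \<in> M" "n \<in> N" "x = m + n"
        by (auto simp: set_plus_def)
      then show "f (c *\<^sub>R x) = c * f x"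
        using M N by (simp add: f subspace_scale scaleR_add_right)
    next
      fix x assume "x \<in> M + N"
      then show "\<bar>f x\<bar> \<le> C * norm z * norm x"
        using bound by (auto simp: set_plus_def)
    qed blast
    have "inner b m = inner m z" if "m \<in> M" for m
      using b[of m] f[of m 0] set_plus_intro[of m M 0 N] that subspace_0[OF N] by simp
    then have "z - b \<in> orthogonal_comp M"
      by (simp add: orthogonal_comp_inner inner_diff_right inner_commute)
    moreover have "inner b n = 0" if "n \<in> N" for n
      using b[of n] f[of 0 n] set_plus_intro[of 0 M n N] that subspace_0[OF M] by simp
    then have "b \<in> orthogonal_comp N"
      by (simp add: orthogonal_comp_inner inner_commute)
    ultimately show ?thesis
      using set_plus_intro[of "z - b" "orthogonal_comp M" b "orthogonal_comp N"] by simp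
  qed
  then show ?thesis
    unfolding W_def by (metis closure_subset_eq subsetI)
qed


section \<open>The relation \<open>P\<^bsub>M,N\<^esub>\<close>\<close>

lemma subspace_if_csubspace:
  assumes "csubspace M"
  shows "subspace M"
  using assms unfolding subspace_def complex_vector.subspace_def
  by (simp add: scaleR_scaleC)

lemma cinner_eq_0_commute: "cinner x y = 0 \<longleftrightarrow> cinner y x = 0"
  by (subst cinner_commute) simp

text \<open>Since \<open>M\<close> contains \<open>\<i> *\<^sub>C m\<close> along with
  \<open>m\<close>, real orthogonality kills the imaginary part of \<open>cinner m x\<close> as
  well.\<close>

lemma ortho_compl_eq_orthogonal_comp:
  assumes "csubspace M"
  shows "ortho_compl M = orthogonal_comp M"
proof -
  have "cinner x m = 0" if x: "\<forall>m\<in>M. inner m x = 0" and m: "m \<in> M" for x m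
  proof -
    have "\<i> *\<^sub>C m \<in> M"
      using assms m by (rule complex_vector.subspace_scale)
    then have "Re (cinner m x) = 0" "Re (\<i> * cinner m x) = 0"
      using x m by (auto simp: inner_eq_Re_cinner cinner_scaleC_left[symmetric] simp del: Re_i_times)
    then have "cinner m x = 0"
      by (simp add: complex_eq_iff)
    then show ?thesis
      by (simp add: cinner_eq_0_commute[of x])
  qed
  moreover have "inner m x = 0" if "cinner x m = 0" for x m :: 'a
    using that by (simp add: inner_eq_Re_cinner cinner_eq_0_commute[of x])
  ultimately show ?thesis
    by (auto simp: ortho_compl_def orthogonal_comp_inner)
qed

section \<open>The adjoint and decomposability\<close>

lemma cinner_add_right: "cinner x (y + z) = cinner x y + cinner x z"
  by (metis cinner_add_left cinner_commute complex_cnj_add)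

lemma cinner_zero_left [simp]: "cinner 0 x = 0"
  using cinner_add_left[of 0 0 x] by simp

text \<open>The adjoint is again of projection type, with the complements exchanged: in
  \<open>cinner m x = cinner (m + n) y\<close>, putting \<open>m = 0\<close> gives \<open>y\<close>
  orthogonal to \<open>N\<close>, and \<open>n = 0\<close> gives \<open>x - y\<close> orthogonal to
  \<open>M\<close>.\<close>

lemma Domain_rel_adjoint_proj_rel:
  assumes M: "0 \<in> M" and N: "0 \<in> N"
  shows "Domain (rel_adjoint (proj_rel M N)) = ortho_compl M + ortho_compl N"
proof -
  have adj: "(x, y) \<in> rel_adjoint (proj_rel M N) \<longleftrightarrow>
      (\<forall>m\<in>M. \<forall>n\<in>N. cinner m x = cinner (m + n) y)" for x y
    by (auto simp: rel_adjoint_def proj_rel_def)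
  have oc: "x \<in> ortho_compl L \<longleftrightarrow> (\<forall>l\<in>L. cinner l x = 0)" for x :: 'a and L
    by (simp add: ortho_compl_def cinner_eq_0_commute[of x])
  have "x \<in> ortho_compl M + ortho_compl N" if "(x, y) \<in> rel_adjoint (proj_rel M N)" for x y
  proof -
    have *: "cinner m x = cinner (m + n) y" if "m \<in> M" "n \<in> N" for m n
      using \<open>(x, y) \<in> _\<close> that by (simp add: adj)
    have "y \<in> ortho_compl N"
      using *[OF M] by (simp add: oc)
    moreover have "cinner m (x - y) = 0" if "m \<in> M" for m
      using *[OF that N] cinner_add_right[of m "x - y" y] by simp
    then have "x - y \<in> ortho_compl M"
      by (simp add: oc)
    ultimately show ?thesis
      using set_plus_intro[of "x - y" "ortho_compl M" y "ortho_compl N"] by simp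
  qed
  moreover have "(a + b, b) \<in> rel_adjoint (proj_rel M N)"
    if "a \<in> ortho_compl M" "b \<in> ortho_compl N" for a b
    using that by (simp add: adj oc cinner_add_right cinner_add_left)
  ultimately show ?thesis
    by (fastforce simp: set_plus_def)
qed

lemma proj_rel_iff:
  fixes M N :: "'a::complex_inner set"
  shows "(x, y) \<in> proj_rel M N \<longleftrightarrow> y \<in> M \<and> x - y \<in> N"
  unfolding proj_rel_def by force

lemma Range_proj_rel:
  assumes "0 \<in> N"
  shows "Range (proj_rel M N) = M"
proof -
  have "y \<in> Range (proj_rel M N)" if "y \<in> M" for y
    using that assms by (intro RangeI[of y]) (simp add: proj_rel_iff)
  then show ?thesis
    by (auto simp: proj_rel_iff)
qed

text \<open>As \<open>m = m + 0\<close> is in the domain, decomposability yields an image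
  \<open>y\<close> of \<open>m\<close> in the closure; then \<open>k = m - y\<close>.\<close>

lemma rel_decomposable_proj_relD:
  assumes M: "subspace M" and N: "subspace N"
    and dec: "rel_decomposable (proj_rel M N)" and m: "m \<in> M"
  shows "\<exists>k\<in>M \<inter> N. m - k \<in> closure (ortho_compl M + ortho_compl N)"
proof -
  have M0: "0 \<in> M" and N0: "0 \<in> N"
    using M N by (auto intro: subspace_0)
  have "m \<in> Domain (proj_rel M N)"
    using m N0 by (auto simp: Domain_iff proj_rel_iff intro!: exI[of _ m])
  then have "m \<in> Domain (rel_op_part (proj_rel M N))"
    using dec by (simp add: rel_decomposable_def)
  then obtain y where "y \<in> M" "m - y \<in> N" "y \<in> closure (ortho_compl M + ortho_compl N)"
    by (auto simp: rel_op_part_def proj_rel_iff Domain_rel_adjoint_proj_rel[OF M0 N0])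
  then show ?thesis
    using M m by (intro bexI[of _ "m - y"]) (auto intro: subspace_diff)
qed

section \<open>Continuity and the angle estimate\<close>

lemma neighbourhood_in_iff:
  fixes x :: "'a::metric_space"
  shows "neighbourhood_in S x V \<longleftrightarrow> V \<subseteq> S \<and> x \<in> S \<and> (\<exists>e>0. ball x e \<inter> S \<subseteq> V)"
proof -
  have "x \<in> top_of_set S interior_of V \<longleftrightarrow> x \<in> S \<and> (\<exists>e>0. ball x e \<inter> S \<subseteq> V)" if "V \<subseteq> S"
  proof
    assume "x \<in> top_of_set S interior_of V"
    then obtain U where "open U" "x \<in> S \<inter> U" "S \<inter> U \<subseteq> V"
      unfolding interior_of_def openin_open by auto
    then show "x \<in> S \<and> (\<exists>e>0. ball x e \<inter> S \<subseteq> V)"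
      by (fastforce simp: open_contains_ball)
  next
    assume "x \<in> S \<and> (\<exists>e>0. ball x e \<inter> S \<subseteq> V)"
    then obtain e where "x \<in> S" "0 < e" "ball x e \<inter> S \<subseteq> V"
      by blast
    moreover have "openin (top_of_set S) (S \<inter> ball x e)"
      by (simp add: openin_open_Int)
    ultimately show "x \<in> top_of_set S interior_of V"
      unfolding interior_of_def by (auto intro!: exI[of _ "S \<inter> ball x e"])
  qed
  then show ?thesis
    unfolding neighbourhood_in_def by blast
qed

text \<open>Continuity is used at \<open>(0, 0)\<close> with the unit ball; homogeneity turns the
  resulting radius \<open>e\<close> into the constant \<open>2 / e\<close>.\<close>

lemma angle_estimate_if_rel_continuous:
  fixes M N W :: "'a::complex_inner set"
  assumes M: "subspace M" and N: "subspace N"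
    and orth: "\<And>k w. k \<in> M \<inter> N \<Longrightarrow> w \<in> W \<Longrightarrow> inner k w = 0"
    and cont: "rel_continuous (proj_rel M N)"
  shows "\<exists>C. \<forall>m\<in>M \<inter> W. \<forall>n\<in>N. norm m \<le> C * norm (m + n)"
proof -
  have M0: "0 \<in> M" and N0: "0 \<in> N"
    using M N by (auto intro: subspace_0)
  have "(0, 0) \<in> proj_rel M N"
    using M0 N0 by (simp add: proj_rel_iff)
  moreover have "neighbourhood_in (Range (proj_rel M N)) 0 (M \<inter> ball 0 1)"
    using M0 by (auto simp: neighbourhood_in_iff Range_proj_rel[OF N0] intro!: exI[of _ 1])
  ultimately have "neighbourhood_in (M + N) 0 ((proj_rel M N)\<inverse> `` (M \<inter> ball 0 1))"
    using cont unfolding rel_continuous_def Domain_proj_rel by blast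
  then obtain e where e: "0 < e" "ball 0 e \<inter> (M + N) \<subseteq> (proj_rel M N)\<inverse> `` (M \<inter> ball 0 1)"
    by (auto simp: neighbourhood_in_iff)
  have small: "norm (t *\<^sub>R m) \<le> 1"
    if mn: "m \<in> M" "m \<in> W" "n \<in> N" and lt: "norm (t *\<^sub>R (m + n)) < e" for t m n
  proof -
    have tm: "t *\<^sub>R m \<in> M" "t *\<^sub>R n \<in> N"
      using mn M N by (auto intro: subspace_scale)
    then have "t *\<^sub>R (m + n) \<in> ball 0 e \<inter> (M + N)"
      using lt unfolding scaleR_add_right by auto
    then have "t *\<^sub>R (m + n) \<in> (proj_rel M N)\<inverse> `` (M \<inter> ball 0 1)"
      using e(2) by blast
    then obtain m1 where m1: "m1 \<in> M" "norm m1 < 1" "t *\<^sub>R (m + n) - m1 \<in> N"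
      by (auto simp: proj_rel_iff)
    \<comment> \<open>Both \<open>t *\<^sub>R m\<close> and \<open>m1\<close> are images of the same
      point, so they differ by an element of \<open>M \<inter> N\<close>. This is orthogonal to
      \<open>m\<close>, so \<open>t *\<^sub>R m\<close> is no longer than \<open>m1\<close>.\<close>
    have "t *\<^sub>R m - m1 = (t *\<^sub>R (m + n) - m1) - t *\<^sub>R n"
      by (simp add: algebra_simps)
    then have "t *\<^sub>R m - m1 \<in> M \<inter> N"
      using m1 tm M N by (metis IntI subspace_diff)
    then have "inner (t *\<^sub>R m - m1) m = 0"
      using mn orth by blast
    then have "inner (t *\<^sub>R m) (t *\<^sub>R m) = inner m1 (t *\<^sub>R m)"
      by (simp add: inner_diff_left)
    then have "norm (t *\<^sub>R m) * norm (t *\<^sub>R m) = inner m1 (t *\<^sub>R m)"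
      by (metis power2_norm_eq_inner power2_eq_square)
    also have "\<dots> \<le> norm m1 * norm (t *\<^sub>R m)"
      by (rule norm_cauchy_schwarz)
    finally have "norm (t *\<^sub>R m) \<le> norm m1 \<or> norm (t *\<^sub>R m) = 0"
      by (metis mult_le_cancel_right norm_ge_zero order_le_less)
    then show ?thesis
      using m1(2) by linarith
  qed
  have "norm m \<le> 2 / e * norm (m + n)" if mn: "m \<in> M" "m \<in> W" "n \<in> N" for m n
  proof (cases "m + n = 0")
    case True
    have "m = - n"
      using True by (simp add: eq_neg_iff_add_eq_0)
    then have "m \<in> M \<inter> N"
      using mn N subspace_neg by blast
    then have "inner m m = 0"
      using mn orth by blast
    then show ?thesis
      using e(1) by simp
  next
    case False
    \<comment> \<open>The factor 2 scales the norm to \<open>e / 2\<close>, strictly inside the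
      ball.\<close>
    then have "norm ((e / (2 * norm (m + n))) *\<^sub>R (m + n)) < e"
      using e(1) by simp
    from small[OF mn this] False e(1) show ?thesis
      by (simp add: field_simps)
  qed
  then show ?thesis by blast
qed

text \<open>An arbitrary image \<open>y'\<close> of a nearby \<open>x'\<close> may be far from
  \<open>y\<close>; correcting \<open>y' - y\<close> by an element of \<open>M \<inter> N\<close>
  moves it into \<open>W\<close>, where it is controlled by \<open>x' - x\<close>.\<close>

lemma rel_continuous_if_angle_estimate:
  fixes M N W :: "'a::complex_inner set"
  assumes M: "subspace M" and N: "subspace N"
    and dec: "\<And>m. m \<in> M \<Longrightarrow> \<exists>k\<in>M \<inter> N. m - k \<in> W"
    and C: "\<And>m n. m \<in> M \<inter> W \<Longrightarrow> n \<in> N \<Longrightarrow> norm m \<le> C * norm (m + n)"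
  shows "rel_continuous (proj_rel M N)"
proof -
  have N0: "0 \<in> N"
    using N by (rule subspace_0)
  have "neighbourhood_in (Domain (proj_rel M N)) x ((proj_rel M N)\<inverse> `` V)"
    if xy: "(x, y) \<in> proj_rel M N" and V: "neighbourhood_in (Range (proj_rel M N)) y V" for x y V
  proof -
    obtain e where e: "0 < e" "ball y e \<inter> M \<subseteq> V"
      using V by (auto simp: neighbourhood_in_iff Range_proj_rel[OF N0])
    \<comment> \<open>Nothing is known about the sign of \<open>C\<close>; this denominator is
      positive and exceeds \<open>C\<close>.\<close>
    define r where "r = e / (\<bar>C\<bar> + 1)"
    have r: "0 < r"
      using e(1) by (simp add: r_def)
    have "x' \<in> (proj_rel M N)\<inverse> `` V" if x': "(x', y') \<in> proj_rel M N" "dist x x' < r" for x' y'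
    proof -
      have yM: "y \<in> M" "x - y \<in> N" "y' \<in> M" "x' - y' \<in> N"
        using xy x' by (auto simp: proj_rel_iff)
      then have "y' - y \<in> M"
        using M by (simp add: subspace_diff)
      then obtain k where k: "k \<in> M" "k \<in> N" "y' - y - k \<in> W"
        using dec by blast
      define m where "m = y' - y - k"
      have m: "m \<in> M" "m \<in> W"
        using k M \<open>y' - y \<in> M\<close> by (auto simp: m_def subspace_diff)
      have xm: "x' - x - m = (x' - y') - (x - y) + k"
        by (simp add: m_def)
      have n: "x' - x - m \<in> N"
        unfolding xm using yM k N by (simp add: subspace_add subspace_diff)
      have "norm m \<le> C * norm (m + (x' - x - m))"
        using m n by (intro C) auto
      also have "\<dots> \<le> (\<bar>C\<bar> + 1) * norm (x' - x)"
        by (simp add: mult_right_mono)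
      also have "\<dots> < (\<bar>C\<bar> + 1) * r"
        using x'(2) by (intro mult_strict_left_mono) (simp_all add: dist_norm norm_minus_commute)
      also have "\<dots> = e"
        by (simp add: r_def)
      finally have "y + m \<in> ball y e"
        by (simp add: dist_norm)
      moreover have "y + m \<in> M"
        using yM m M by (simp add: subspace_add)
      ultimately have "y + m \<in> V"
        using e(2) by blast
      moreover have "x' - (y + m) = (x - y) + (x' - x - m)"
        by simp
      then have "x' - (y + m) \<in> N"
        using yM n N by (metis subspace_add)
      ultimately show ?thesis
        using \<open>y + m \<in> M\<close> by (auto simp: proj_rel_iff)
    qed
    then have "ball x r \<inter> Domain (proj_rel M N) \<subseteq> (proj_rel M N)\<inverse> `` V"
      by fastforce
    then show ?thesis
      using r xy by (fastforce simp: neighbourhood_in_iff)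
  qed
  then show ?thesis
    unfolding rel_continuous_def by blast
qed

theorem proposition4p7:
  fixes M N :: "'a::complex_hilbert_space set"
  assumes "separable_space (euclidean :: 'a topology)"
    and "csubspace M" and "csubspace N"
    and "rel_decomposable (proj_rel M N)"
  shows "rel_continuous (proj_rel M N) \<longleftrightarrow> closed (ortho_compl M + ortho_compl N)"
proof -
  define W where "W = orthogonal_comp M + orthogonal_comp N"
  have M: "subspace M" and N: "subspace N"
    using assms by (auto intro: subspace_if_csubspace)
  have W: "ortho_compl M + ortho_compl N = W"
    using assms by (simp add: W_def ortho_compl_eq_orthogonal_comp)
  have dec: "\<exists>k\<in>M \<inter> N. m - k \<in> closure W" if "m \<in> M" for m
    using rel_decomposable_proj_relD[OF M N assms(4) that] by (simp add: W)
  show ?thesis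
    unfolding W
  proof
    assume "rel_continuous (proj_rel M N)"
    then obtain C where "\<forall>m\<in>M \<inter> closure W. \<forall>n\<in>N. norm m \<le> C * norm (m + n)"
      using angle_estimate_if_rel_continuous[OF M N, of "closure W"] inter_orthogonal_closure_sum
      unfolding W_def by blast
    then show "closed W"
      using closed_if_angle_estimate[OF M N] dec unfolding W_def by blast
  next
    assume closed: "closed W"
    then obtain C where "\<forall>m\<in>M \<inter> W. \<forall>n\<in>N. norm m \<le> C * norm (m + n)"
      using angle_estimate_if_closed[OF M N] unfolding W_def by blast
    \<comment> \<open>As \<open>W\<close> equals its closure, \<open>dec\<close> corrects into the
      very set on which the estimate holds.\<close>
    then show "rel_continuous (proj_rel M N)"
      using rel_continuous_if_angle_estimate[OF M N, of W C] dec closed by (simp add: closure_closed)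
  qed
qed

end
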